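(* Intuitionistic propositional logic $\mathsf{IPC}$ has both the propositional disjunctive interpolation property $\mathrm{PDIP}$ and its monotone version $\mathrm{mPDIP}$.
   Context: Formulas are over $\{\top,\bot,\wedge,\vee,\to\}$; $V(\phi)$ is the set of atoms of $\phi$; a formula is monotone if it contains no implication (negation $\neg\phi$ abbreviates $\phi\to\bot$). For a superintuitionistic logic $L$, an $L$-propositional disjunctive interpolant ($L$-PDI) for $(\phi\to\psi\vee\theta)\in L$ is a pair $(I,J)$ of formulas with $V(I),V(J)\subseteq V(\phi)$ such that $\phi\to(I\vee J)$, $I\to\psi$ and $J\to\theta$ are in $L$. An $L$-mPDI is an $L$-PDI where additionally $\phi$, $I$, $J$ are monotone. $L$ has PDIP if every $(\phi\to\psi\vee\theta)\in L$ has an $L$-PDI, and has mPDIP if every $(\phi\to\psi\vee\theta)\in L$ with $\phi$ monotone has an $L$-mPDI. *)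

theory Defs
  imports Main
begin

datatype (atoms: 'a) fm =
    Atom 'a
  | Top  (\<open>\<^bold>\<top>\<close>)
  | Bot  (\<open>\<^bold>\<bottom>\<close>)
  | Conj "'a fm" "'a fm"  (infixr \<open>\<^bold>\<and>\<close> 68)
  | Disj "'a fm" "'a fm"  (infixr \<open>\<^bold>\<or>\<close> 67)
  | Imp "'a fm" "'a fm"  (infixr \<open>\<^bold>\<rightarrow>\<close> 66)

primrec monotone_fm :: "'a fm \<Rightarrow> bool" where
  "monotone_fm (Atom p) \<longleftrightarrow> True"
| "monotone_fm \<^bold>\<top> \<longleftrightarrow> True"
| "monotone_fm \<^bold>\<bottom> \<longleftrightarrow> True"
| "monotone_fm (A \<^bold>\<and> B) \<longleftrightarrow> monotone_fm A \<and> monotone_fm B"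
| "monotone_fm (A \<^bold>\<or> B) \<longleftrightarrow> monotone_fm A \<and> monotone_fm B"
| "monotone_fm (A \<^bold>\<rightarrow> B) \<longleftrightarrow> False"

primrec subst_fm :: "('a \<Rightarrow> 'b fm) \<Rightarrow> 'a fm \<Rightarrow> 'b fm" where
  "subst_fm \<sigma> (Atom p) = \<sigma> p"
| "subst_fm \<sigma> \<^bold>\<top> = \<^bold>\<top>"
| "subst_fm \<sigma> \<^bold>\<bottom> = \<^bold>\<bottom>"
| "subst_fm \<sigma> (A \<^bold>\<and> B) = subst_fm \<sigma> A \<^bold>\<and> subst_fm \<sigma> B"
| "subst_fm \<sigma> (A \<^bold>\<or> B) = subst_fm \<sigma> A \<^bold>\<or> subst_fm \<sigma> B"
| "subst_fm \<sigma> (A \<^bold>\<rightarrow> B) = subst_fm \<sigma> A \<^bold>\<rightarrow> subst_fm \<sigma> B"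

text \<open>Intuitionistic propositional logic as the set of theorems of the standard Hilbert system:
  axiom schemes closed under modus ponens.\<close>

inductive_set IPC :: "'a fm set" where
  K: "A \<^bold>\<rightarrow> B \<^bold>\<rightarrow> A \<in> IPC"
| S: "(A \<^bold>\<rightarrow> B \<^bold>\<rightarrow> C) \<^bold>\<rightarrow> (A \<^bold>\<rightarrow> B) \<^bold>\<rightarrow> A \<^bold>\<rightarrow> C \<in> IPC"
| ConjE1: "A \<^bold>\<and> B \<^bold>\<rightarrow> A \<in> IPC"
| ConjE2: "A \<^bold>\<and> B \<^bold>\<rightarrow> B \<in> IPC"
| ConjI: "A \<^bold>\<rightarrow> B \<^bold>\<rightarrow> A \<^bold>\<and> B \<in> IPC"
| DisjI1: "A \<^bold>\<rightarrow> A \<^bold>\<or> B \<in> IPC"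
| DisjI2: "B \<^bold>\<rightarrow> A \<^bold>\<or> B \<in> IPC"
| DisjE: "(A \<^bold>\<rightarrow> C) \<^bold>\<rightarrow> (B \<^bold>\<rightarrow> C) \<^bold>\<rightarrow> A \<^bold>\<or> B \<^bold>\<rightarrow> C \<in> IPC"
| TopI: "\<^bold>\<top> \<in> IPC"
| BotE: "\<^bold>\<bottom> \<^bold>\<rightarrow> A \<in> IPC"
| MP: "A \<^bold>\<rightarrow> B \<in> IPC \<Longrightarrow> A \<in> IPC \<Longrightarrow> B \<in> IPC"

definition superintuitionistic :: "'a fm set \<Rightarrow> bool" where
  "superintuitionistic L \<longleftrightarrow>
     IPC \<subseteq> L \<and>
     (\<forall>A B. A \<^bold>\<rightarrow> B \<in> L \<longrightarrow> A \<in> L \<longrightarrow> B \<in> L) \<and>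
     (\<forall>\<sigma> A. A \<in> L \<longrightarrow> subst_fm \<sigma> A \<in> L)"

lemma IPC_subst: "A \<in> IPC \<Longrightarrow> subst_fm \<sigma> A \<in> IPC"
  by (induction rule: IPC.induct) (auto intro: IPC.intros)

lemma superintuitionistic_IPC: "superintuitionistic IPC"
  by (auto simp: superintuitionistic_def intro: IPC.MP IPC_subst)

text \<open>The following notions are meant for superintuitionistic \<open>L\<close>. The membership
  \<open>\<phi> \<^bold>\<rightarrow> \<psi> \<^bold>\<or> \<theta> \<in> L\<close> presupposed of an interpolated formula is a hypothesis in \<open>PDIP\<close> and
  \<open>mPDIP\<close>.\<close>

definition PDI :: "'a fm set \<Rightarrow> 'a fm \<Rightarrow> 'a fm \<Rightarrow> 'a fm \<Rightarrow> 'a fm \<times> 'a fm \<Rightarrow> bool" where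
  "PDI L \<phi> \<psi> \<theta> = (\<lambda>(I, J).
     atoms I \<subseteq> atoms \<phi> \<and> atoms J \<subseteq> atoms \<phi> \<and>
     \<phi> \<^bold>\<rightarrow> (I \<^bold>\<or> J) \<in> L \<and> I \<^bold>\<rightarrow> \<psi> \<in> L \<and> J \<^bold>\<rightarrow> \<theta> \<in> L)"

definition mPDI :: "'a fm set \<Rightarrow> 'a fm \<Rightarrow> 'a fm \<Rightarrow> 'a fm \<Rightarrow> 'a fm \<times> 'a fm \<Rightarrow> bool" where
  "mPDI L \<phi> \<psi> \<theta> = (\<lambda>(I, J).
     PDI L \<phi> \<psi> \<theta> (I, J) \<and> monotone_fm \<phi> \<and> monotone_fm I \<and> monotone_fm J)"

definition PDIP :: "'a fm set \<Rightarrow> bool" where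
  "PDIP L \<longleftrightarrow> (\<forall>\<phi> \<psi> \<theta>. \<phi> \<^bold>\<rightarrow> \<psi> \<^bold>\<or> \<theta> \<in> L \<longrightarrow> (\<exists>I J. PDI L \<phi> \<psi> \<theta> (I, J)))"

definition mPDIP :: "'a fm set \<Rightarrow> bool" where
  "mPDIP L \<longleftrightarrow>
     (\<forall>\<phi> \<psi> \<theta>. monotone_fm \<phi> \<longrightarrow> \<phi> \<^bold>\<rightarrow> \<psi> \<^bold>\<or> \<theta> \<in> L \<longrightarrow> (\<exists>I J. mPDI L \<phi> \<psi> \<theta> (I, J)))"

end

theory Submission
  imports Defs
begin

text \<open>
  Let \<open>S\<close> be the finite set of subformulas of \<open>\<phi>\<close>, and call \<open>\<Delta> \<subseteq> S\<close> saturated if it contains every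
  member of \<open>S\<close> that it derives and a disjunct of each of its disjunctions. Each member of a saturated
  set \<open>\<Delta>\<close> is slashed by \<open>\<Delta>\<close> in the sense of Kleene and Aczel, so \<open>\<Delta>\<close> has the disjunction property:
  from \<open>\<phi> \<tturnstile> \<psi> \<^bold>\<or> \<theta>\<close>, every saturated \<open>\<Delta>\<close> containing \<open>\<phi>\<close> derives \<open>\<psi>\<close> or \<open>\<theta>\<close>. By a finite version of
  Lindenbaum's lemma, \<open>\<phi>\<close> derives whatever all these \<open>\<Delta>\<close> derive. Hence the disjunction of all
  \<open>\<^bold>\<And> \<Delta>\<close> with \<open>\<Delta>\<close> saturated and \<open>\<Delta> \<tturnstile> \<psi>\<close> is a possible \<open>I\<close>, and likewise with \<open>\<theta>\<close> for \<open>J\<close>.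
  Being built from subformulas of \<open>\<phi>\<close> by conjunction and disjunction, both are monotone if \<open>\<phi>\<close> is.
\<close>

inductive derives :: "'a fm set \<Rightarrow> 'a fm \<Rightarrow> bool" (infix \<open>\<tturnstile>\<close> 50) for \<Gamma> where
  Hyp: "A \<in> \<Gamma> \<Longrightarrow> \<Gamma> \<tturnstile> A"
| Thm: "A \<in> IPC \<Longrightarrow> \<Gamma> \<tturnstile> A"
| MP: "\<Gamma> \<tturnstile> A \<^bold>\<rightarrow> B \<Longrightarrow> \<Gamma> \<tturnstile> A \<Longrightarrow> \<Gamma> \<tturnstile> B"

lemma derives_cut:
  assumes "\<Delta> \<tturnstile> A" "\<And>D. D \<in> \<Delta> \<Longrightarrow> \<Gamma> \<tturnstile> D"
  shows "\<Gamma> \<tturnstile> A"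
  using assms by (induction rule: derives.induct) (auto intro: derives.intros)

lemma derives_mono: "\<Delta> \<tturnstile> A \<Longrightarrow> \<Delta> \<subseteq> \<Gamma> \<Longrightarrow> \<Gamma> \<tturnstile> A"
  by (erule derives_cut) (auto intro: derives.Hyp)

lemma derives_ImpI:
  assumes "insert A \<Gamma> \<tturnstile> B"
  shows "\<Gamma> \<tturnstile> A \<^bold>\<rightarrow> B"
  using assms
proof (induction rule: derives.induct)
  case (Hyp B)
  have "A \<^bold>\<rightarrow> A \<in> IPC"
    using IPC.S[of A "A \<^bold>\<rightarrow> A" A] IPC.K IPC.MP by blast
  then show ?case
    using Hyp by (auto intro: derives.intros IPC.K)
next
  case (Thm B)
  then show ?case by (auto intro: derives.intros IPC.intros)
next
  case (MP B C)
  then show ?case by (meson derives.Thm derives.MP IPC.S)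
qed

lemma derives_Imp_iff: "\<Gamma> \<tturnstile> A \<^bold>\<rightarrow> B \<longleftrightarrow> insert A \<Gamma> \<tturnstile> B"
  by (meson derives_ImpI derives_mono derives.Hyp derives.MP insertI1 subset_insertI)

lemma derives_empty_iff: "{} \<tturnstile> A \<longleftrightarrow> A \<in> IPC"
proof
  show "{} \<tturnstile> A \<Longrightarrow> A \<in> IPC"
    by (induction rule: derives.induct) (auto intro: IPC.MP)
qed (rule derives.Thm)

lemma Imp_IPC_iff: "A \<^bold>\<rightarrow> B \<in> IPC \<longleftrightarrow> {A} \<tturnstile> B"
  using derives_Imp_iff[of "{}"] by (simp add: derives_empty_iff)

lemma derives_Top: "\<Gamma> \<tturnstile> \<^bold>\<top>"
  by (intro derives.Thm IPC.TopI)

lemma derives_BotE: "\<Gamma> \<tturnstile> \<^bold>\<bottom> \<Longrightarrow> \<Gamma> \<tturnstile> A"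
  by (meson derives.Thm derives.MP IPC.BotE)

lemma derives_Conj_iff: "\<Gamma> \<tturnstile> A \<^bold>\<and> B \<longleftrightarrow> \<Gamma> \<tturnstile> A \<and> \<Gamma> \<tturnstile> B"
  by (meson derives.Thm derives.MP IPC.ConjI IPC.ConjE1 IPC.ConjE2)

lemma derives_DisjI1: "\<Gamma> \<tturnstile> A \<Longrightarrow> \<Gamma> \<tturnstile> A \<^bold>\<or> B"
  by (meson derives.Thm derives.MP IPC.DisjI1)

lemma derives_DisjI2: "\<Gamma> \<tturnstile> B \<Longrightarrow> \<Gamma> \<tturnstile> A \<^bold>\<or> B"
  by (meson derives.Thm derives.MP IPC.DisjI2)

lemma derives_DisjE:
  "\<Gamma> \<tturnstile> A \<^bold>\<or> B \<Longrightarrow> insert A \<Gamma> \<tturnstile> C \<Longrightarrow> insert B \<Gamma> \<tturnstile> C \<Longrightarrow> \<Gamma> \<tturnstile> C"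
  by (meson derives_ImpI derives.Thm derives.MP IPC.DisjE)

definition enumeration :: "'a set \<Rightarrow> 'a list" where
  "enumeration X = (SOME xs. set xs = X)"

definition BigConj :: "'a fm set \<Rightarrow> 'a fm" (\<open>\<^bold>\<And>\<close>) where
  "\<^bold>\<And> \<Gamma> = foldr Conj (enumeration \<Gamma>) \<^bold>\<top>"

definition BigDisj :: "'a fm set \<Rightarrow> 'a fm" (\<open>\<^bold>\<Or>\<close>) where
  "\<^bold>\<Or> \<Gamma> = foldr Disj (enumeration \<Gamma>) \<^bold>\<bottom>"

lemma set_enumeration: "finite X \<Longrightarrow> set (enumeration X) = X"
  unfolding enumeration_def by (rule someI_ex) (rule finite_list)

lemma
  assumes "finite \<Gamma>"
  shows atoms_BigConj: "atoms (\<^bold>\<And> \<Gamma>) = \<Union> (atoms ` \<Gamma>)"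
    and atoms_BigDisj: "atoms (\<^bold>\<Or> \<Gamma>) = \<Union> (atoms ` \<Gamma>)"
proof -
  have "atoms (foldr Conj As \<^bold>\<top>) = \<Union> (atoms ` set As)"
    and "atoms (foldr Disj As \<^bold>\<bottom>) = \<Union> (atoms ` set As)" for As :: "'a fm list"
    by (induction As, auto)+
  then show "atoms (\<^bold>\<And> \<Gamma>) = \<Union> (atoms ` \<Gamma>)" and "atoms (\<^bold>\<Or> \<Gamma>) = \<Union> (atoms ` \<Gamma>)"
    using assms by (simp_all add: BigConj_def BigDisj_def set_enumeration)
qed

lemma
  assumes "finite \<Gamma>"
  shows monotone_BigConj_iff: "monotone_fm (\<^bold>\<And> \<Gamma>) \<longleftrightarrow> (\<forall>A \<in> \<Gamma>. monotone_fm A)"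
    and monotone_BigDisj_iff: "monotone_fm (\<^bold>\<Or> \<Gamma>) \<longleftrightarrow> (\<forall>A \<in> \<Gamma>. monotone_fm A)"
proof -
  have "monotone_fm (foldr Conj As \<^bold>\<top>) \<longleftrightarrow> (\<forall>A \<in> set As. monotone_fm A)"
    and "monotone_fm (foldr Disj As \<^bold>\<bottom>) \<longleftrightarrow> (\<forall>A \<in> set As. monotone_fm A)"
    for As :: "'a fm list"
    by (induction As, auto)+
  then show "monotone_fm (\<^bold>\<And> \<Gamma>) \<longleftrightarrow> (\<forall>A \<in> \<Gamma>. monotone_fm A)"
    and "monotone_fm (\<^bold>\<Or> \<Gamma>) \<longleftrightarrow> (\<forall>A \<in> \<Gamma>. monotone_fm A)"
    using assms by (simp_all add: BigConj_def BigDisj_def set_enumeration)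
qed

lemma derives_BigConj_iff:
  assumes "finite \<Delta>"
  shows "\<Gamma> \<tturnstile> \<^bold>\<And> \<Delta> \<longleftrightarrow> (\<forall>A \<in> \<Delta>. \<Gamma> \<tturnstile> A)"
proof -
  have "\<Gamma> \<tturnstile> foldr Conj As \<^bold>\<top> \<longleftrightarrow> (\<forall>A \<in> set As. \<Gamma> \<tturnstile> A)" for As
    by (induction As) (auto simp: derives_Conj_iff derives_Top)
  then show ?thesis
    using assms by (simp add: BigConj_def set_enumeration)
qed

lemma derives_BigDisjI:
  assumes "finite \<Delta>" "A \<in> \<Delta>" "\<Gamma> \<tturnstile> A"
  shows "\<Gamma> \<tturnstile> \<^bold>\<Or> \<Delta>"
proof -
  have "\<Gamma> \<tturnstile> foldr Disj As \<^bold>\<bottom>" if "A \<in> set As" for As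
    using that by (induction As) (auto intro: assms(3) derives_DisjI1 derives_DisjI2)
  then show ?thesis
    using assms by (simp add: BigDisj_def set_enumeration)
qed

lemma derives_BigDisjE:
  assumes "finite \<Delta>" "\<Gamma> \<tturnstile> \<^bold>\<Or> \<Delta>" "\<And>A. A \<in> \<Delta> \<Longrightarrow> insert A \<Gamma> \<tturnstile> C"
  shows "\<Gamma> \<tturnstile> C"
proof -
  have "\<Gamma> \<tturnstile> foldr Disj As \<^bold>\<bottom> \<^bold>\<rightarrow> C" if "set As \<subseteq> \<Delta>" for As
    using that
  proof (induction As)
    case Nil
    show ?case by (auto intro: derives.Thm IPC.BotE)
  next
    case (Cons A As)
    have "\<Gamma> \<tturnstile> A \<^bold>\<rightarrow> C" "\<Gamma> \<tturnstile> foldr Disj As \<^bold>\<bottom> \<^bold>\<rightarrow> C"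
      using Cons assms(3) by (auto intro: derives_ImpI)
    then show ?case
      unfolding foldr.simps o_apply by (meson derives.MP derives.Thm IPC.DisjE)
  qed
  then have "\<Gamma> \<tturnstile> \<^bold>\<Or> \<Delta> \<^bold>\<rightarrow> C"
    using assms(1) by (simp add: BigDisj_def set_enumeration)
  then show ?thesis
    using assms(2) by (rule derives.MP)
qed

primrec slash :: "'a fm set \<Rightarrow> 'a fm \<Rightarrow> bool" where
  "slash \<Gamma> (Atom p) \<longleftrightarrow> \<Gamma> \<tturnstile> Atom p"
| "slash \<Gamma> \<^bold>\<top> \<longleftrightarrow> True"
| "slash \<Gamma> \<^bold>\<bottom> \<longleftrightarrow> \<Gamma> \<tturnstile> \<^bold>\<bottom>"
| "slash \<Gamma> (A \<^bold>\<and> B) \<longleftrightarrow> slash \<Gamma> A \<and> slash \<Gamma> B"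
| "slash \<Gamma> (A \<^bold>\<or> B) \<longleftrightarrow> slash \<Gamma> A \<or> slash \<Gamma> B"
| "slash \<Gamma> (A \<^bold>\<rightarrow> B) \<longleftrightarrow> \<Gamma> \<tturnstile> A \<^bold>\<rightarrow> B \<and> (slash \<Gamma> A \<longrightarrow> slash \<Gamma> B)"

lemma derives_if_slash: "slash \<Gamma> A \<Longrightarrow> \<Gamma> \<tturnstile> A"
  by (induction A) (auto simp: derives_Top derives_Conj_iff intro: derives_DisjI1 derives_DisjI2)

lemma slash_if_derives_Bot: "\<Gamma> \<tturnstile> \<^bold>\<bottom> \<Longrightarrow> slash \<Gamma> A"
  by (induction A) (auto intro: derives_BotE)

lemma slash_IPC:
  assumes "A \<in> IPC"
  shows "slash \<Gamma> A"
  using assms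
proof (induction rule: IPC.induct)
  case (K A B)
  then show ?case
    by (auto intro: derives.Thm derives.MP IPC.K derives_if_slash)
next
  case (S A B C)
  have S_axiom: "\<Gamma> \<tturnstile> (A \<^bold>\<rightarrow> B \<^bold>\<rightarrow> C) \<^bold>\<rightarrow> (A \<^bold>\<rightarrow> B) \<^bold>\<rightarrow> A \<^bold>\<rightarrow> C"
    by (intro derives.Thm IPC.S)
  then show ?case
    using derives.MP[OF S_axiom] derives.MP[OF derives.MP[OF S_axiom]] by auto
next
  case (ConjI A B)
  then show ?case
    by (auto intro: derives.Thm derives.MP IPC.ConjI derives_if_slash)
next
  case (DisjE A C B)
  have DisjE_axiom: "\<Gamma> \<tturnstile> (A \<^bold>\<rightarrow> C) \<^bold>\<rightarrow> (B \<^bold>\<rightarrow> C) \<^bold>\<rightarrow> A \<^bold>\<or> B \<^bold>\<rightarrow> C"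
    by (intro derives.Thm IPC.DisjE)
  then show ?case
    using derives.MP[OF DisjE_axiom] derives.MP[OF derives.MP[OF DisjE_axiom]] by auto
qed (auto intro: derives.Thm IPC.intros slash_if_derives_Bot)

lemma slash_if_derives:
  assumes "\<Gamma> \<tturnstile> A" "\<And>B. B \<in> \<Gamma> \<Longrightarrow> slash \<Gamma> B"
  shows "slash \<Gamma> A"
  using assms by (induction rule: derives.induct) (auto intro: slash_IPC)

lemma disjunction_property_if_slash:
  assumes "\<And>C. C \<in> \<Gamma> \<Longrightarrow> slash \<Gamma> C" "\<Gamma> \<tturnstile> A \<^bold>\<or> B"
  shows "\<Gamma> \<tturnstile> A \<or> \<Gamma> \<tturnstile> B"
proof -
  have "slash \<Gamma> (A \<^bold>\<or> B)"
    using assms(2,1) by (rule slash_if_derives)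
  then show ?thesis
    by (auto intro: derives_if_slash)
qed

primrec subfms :: "'a fm \<Rightarrow> 'a fm set" where
  "subfms (Atom p) = {Atom p}"
| "subfms \<^bold>\<top> = {\<^bold>\<top>}"
| "subfms \<^bold>\<bottom> = {\<^bold>\<bottom>}"
| "subfms (A \<^bold>\<and> B) = insert (A \<^bold>\<and> B) (subfms A \<union> subfms B)"
| "subfms (A \<^bold>\<or> B) = insert (A \<^bold>\<or> B) (subfms A \<union> subfms B)"
| "subfms (A \<^bold>\<rightarrow> B) = insert (A \<^bold>\<rightarrow> B) (subfms A \<union> subfms B)"

lemma self_in_subfms: "A \<in> subfms A"
  by (cases A) auto

lemma finite_subfms: "finite (subfms A)"
  by (induction A) auto

lemma atoms_subfms: "B \<in> subfms A \<Longrightarrow> atoms B \<subseteq> atoms A"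
  by (induction A) auto

lemma monotone_subfms: "B \<in> subfms A \<Longrightarrow> monotone_fm A \<Longrightarrow> monotone_fm B"
  by (induction A) auto

definition subfm_closed :: "'a fm set \<Rightarrow> bool" where
  "subfm_closed S \<longleftrightarrow> (\<forall>A \<in> S. subfms A \<subseteq> S)"

lemma subfm_closed_subfms: "subfm_closed (subfms A)"
  by (induction A) (auto simp: subfm_closed_def)

lemma subfm_closedD:
  assumes "subfm_closed S"
  shows "A \<^bold>\<and> B \<in> S \<Longrightarrow> A \<in> S \<and> B \<in> S"
    and "A \<^bold>\<or> B \<in> S \<Longrightarrow> A \<in> S \<and> B \<in> S"
    and "A \<^bold>\<rightarrow> B \<in> S \<Longrightarrow> A \<in> S \<and> B \<in> S"
  using assms self_in_subfms[of A] self_in_subfms[of B] by (fastforce simp: subfm_closed_def)+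

definition saturated :: "'a fm set \<Rightarrow> 'a fm set \<Rightarrow> bool" where
  "saturated S \<Delta> \<longleftrightarrow> \<Delta> \<subseteq> S \<and> (\<forall>A \<in> S. \<Delta> \<tturnstile> A \<longrightarrow> A \<in> \<Delta>) \<and>
     (\<forall>A B. A \<^bold>\<or> B \<in> \<Delta> \<longrightarrow> A \<in> \<Delta> \<or> B \<in> \<Delta>)"

lemma
  assumes "saturated S \<Delta>"
  shows saturated_subset: "\<Delta> \<subseteq> S"
    and saturated_derives: "A \<in> S \<Longrightarrow> \<Delta> \<tturnstile> A \<Longrightarrow> A \<in> \<Delta>"
    and saturated_Disj: "A \<^bold>\<or> B \<in> \<Delta> \<Longrightarrow> A \<in> \<Delta> \<or> B \<in> \<Delta>"
  using assms by (auto simp: saturated_def)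

lemma finite_if_saturated: "finite S \<Longrightarrow> saturated S \<Delta> \<Longrightarrow> finite \<Delta>"
  using saturated_subset by (rule finite_subset)

lemma finite_Collect_saturated: "finite S \<Longrightarrow> finite {\<Delta>. saturated S \<Delta> \<and> P \<Delta>}"
  by (rule finite_subset[of _ "Pow S"]) (auto dest: saturated_subset)

lemma slash_saturated:
  assumes "subfm_closed S" "saturated S \<Delta>" "A \<in> \<Delta>"
  shows "slash \<Delta> A"
  using assms(3)
proof (induction A)
  case (Conj A B)
  have "A \<in> S" "B \<in> S"
    using Conj.prems saturated_subset[OF assms(2)] subfm_closedD(1)[OF assms(1)] by blast+
  moreover have "\<Delta> \<tturnstile> A" "\<Delta> \<tturnstile> B"
    using derives.Hyp[OF Conj.prems] by (auto simp: derives_Conj_iff)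
  ultimately show ?case
    using Conj.IH by (simp add: saturated_derives[OF assms(2)])
next
  case (Disj A B)
  then show ?case
    using saturated_Disj[OF assms(2)] by auto
next
  case (Imp A B)
  have "slash \<Delta> B" if "slash \<Delta> A"
  proof -
    have "\<Delta> \<tturnstile> B"
      using derives.Hyp[OF Imp.prems] derives_if_slash[OF that] by (rule derives.MP)
    moreover have "B \<in> S"
      using Imp.prems saturated_subset[OF assms(2)] subfm_closedD(3)[OF assms(1)] by blast
    ultimately show ?thesis
      using Imp.IH(2) by (simp add: saturated_derives[OF assms(2)])
  qed
  then show ?case
    using derives.Hyp[OF Imp.prems] by simp
qed (auto intro: derives.Hyp)

lemma finite_Lindenbaum:
  assumes "finite S" "subfm_closed S"
    and "\<Gamma> \<subseteq> S" "\<And>\<Delta>. saturated S \<Delta> \<Longrightarrow> \<Gamma> \<subseteq> \<Delta> \<Longrightarrow> \<Delta> \<tturnstile> C"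
  shows "\<Gamma> \<tturnstile> C"
  using assms(3,4)
proof (induction "card (S - \<Gamma>)" arbitrary: \<Gamma> rule: less_induct)
  case less
  have extend: "insert A \<Gamma> \<tturnstile> C" if "A \<in> S" "A \<notin> \<Gamma>" for A
  proof (rule less.hyps)
    show "card (S - insert A \<Gamma>) < card (S - \<Gamma>)"
      using assms(1) that by (intro psubset_card_mono) auto
  qed (use less.prems that in auto)
  consider (saturated) "saturated S \<Gamma>"
    | (derivable) A where "A \<in> S" "\<Gamma> \<tturnstile> A" "A \<notin> \<Gamma>"
    | (disjunction) A B where "A \<^bold>\<or> B \<in> \<Gamma>" "A \<notin> \<Gamma>" "B \<notin> \<Gamma>"
    using less.prems(1) unfolding saturated_def by blast
  then show ?case
  proof cases
    case saturated
    then show ?thesis by (intro less.prems(2)) auto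
  next
    case derivable
    from extend[OF \<open>A \<in> S\<close> \<open>A \<notin> \<Gamma>\<close>] show ?thesis
      by (rule derives_cut) (use \<open>\<Gamma> \<tturnstile> A\<close> in \<open>auto intro: derives.Hyp\<close>)
  next
    case disjunction
    then have "A \<in> S" "B \<in> S"
      using less.prems(1) subfm_closedD(2)[OF assms(2)] by blast+
    with disjunction show ?thesis
      by (blast intro: derives_DisjE derives.Hyp extend)
  qed
qed

definition interpolant :: "'a fm set \<Rightarrow> 'a fm \<Rightarrow> 'a fm" where
  "interpolant S \<psi> = \<^bold>\<Or> (\<^bold>\<And> ` {\<Delta>. saturated S \<Delta> \<and> \<Delta> \<tturnstile> \<psi>})"

lemma atoms_interpolant:
  assumes "finite S"
  shows "atoms (interpolant S \<psi>) \<subseteq> \<Union> (atoms ` S)"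
  using assms unfolding interpolant_def
  by (fastforce simp: atoms_BigDisj atoms_BigConj finite_Collect_saturated finite_if_saturated
      dest: saturated_subset)

lemma monotone_interpolant:
  assumes "finite S" "\<And>A. A \<in> S \<Longrightarrow> monotone_fm A"
  shows "monotone_fm (interpolant S \<psi>)"
  using assms unfolding interpolant_def
  by (auto simp: monotone_BigDisj_iff monotone_BigConj_iff finite_Collect_saturated
      finite_if_saturated dest: saturated_subset)

lemma interpolant_derives:
  assumes "finite S"
  shows "{interpolant S \<psi>} \<tturnstile> \<psi>"
proof (rule derives_BigDisjE)
  let ?\<X> = "{\<Delta>. saturated S \<Delta> \<and> \<Delta> \<tturnstile> \<psi>}"
  show "finite (\<^bold>\<And> ` ?\<X>)"
    using assms by (simp add: finite_Collect_saturated)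
  show "{interpolant S \<psi>} \<tturnstile> \<^bold>\<Or> (\<^bold>\<And> ` ?\<X>)"
    by (auto simp: interpolant_def intro: derives.Hyp)
  fix A assume "A \<in> \<^bold>\<And> ` ?\<X>"
  then obtain \<Delta> where "A = \<^bold>\<And> \<Delta>" "saturated S \<Delta>" "\<Delta> \<tturnstile> \<psi>" by blast
  moreover have "{\<^bold>\<And> \<Delta>} \<tturnstile> D" if "D \<in> \<Delta>" for D
    using derives_BigConj_iff[of \<Delta> "{\<^bold>\<And> \<Delta>}"] finite_if_saturated[OF assms \<open>saturated S \<Delta>\<close>] that
    by (auto intro: derives.Hyp)
  ultimately have "{A} \<tturnstile> \<psi>"
    by (auto intro: derives_cut)
  then show "insert A {interpolant S \<psi>} \<tturnstile> \<psi>"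
    by (rule derives_mono) auto
qed

lemma saturated_derives_interpolant:
  assumes "finite S" "saturated S \<Delta>" "\<Delta> \<tturnstile> \<psi>"
  shows "\<Delta> \<tturnstile> interpolant S \<psi>"
  unfolding interpolant_def
proof (rule derives_BigDisjI)
  show "\<Delta> \<tturnstile> \<^bold>\<And> \<Delta>"
    using assms by (auto simp: derives_BigConj_iff finite_if_saturated intro: derives.Hyp)
qed (use assms in \<open>auto simp: finite_Collect_saturated\<close>)

lemma derives_Disj_interpolants:
  assumes "finite S" "subfm_closed S" "\<Gamma> \<subseteq> S" "\<Gamma> \<tturnstile> \<psi> \<^bold>\<or> \<theta>"
  shows "\<Gamma> \<tturnstile> interpolant S \<psi> \<^bold>\<or> interpolant S \<theta>"
  using assms(1-3)
proof (rule finite_Lindenbaum)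
  fix \<Delta> assume "saturated S \<Delta>" "\<Gamma> \<subseteq> \<Delta>"
  have "\<Delta> \<tturnstile> \<psi> \<^bold>\<or> \<theta>"
    using assms(4) \<open>\<Gamma> \<subseteq> \<Delta>\<close> by (rule derives_mono)
  then have "\<Delta> \<tturnstile> \<psi> \<or> \<Delta> \<tturnstile> \<theta>"
    using slash_saturated[OF assms(2) \<open>saturated S \<Delta>\<close>] by (intro disjunction_property_if_slash)
  then show "\<Delta> \<tturnstile> interpolant S \<psi> \<^bold>\<or> interpolant S \<theta>"
    using saturated_derives_interpolant[OF assms(1) \<open>saturated S \<Delta>\<close>]
    by (blast intro: derives_DisjI1 derives_DisjI2)
qed

lemma PDI_interpolants:
  assumes "\<phi> \<^bold>\<rightarrow> \<psi> \<^bold>\<or> \<theta> \<in> IPC"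
  shows "PDI IPC \<phi> \<psi> \<theta> (interpolant (subfms \<phi>) \<psi>, interpolant (subfms \<phi>) \<theta>)"
proof -
  have "atoms (interpolant (subfms \<phi>) \<chi>) \<subseteq> atoms \<phi>" for \<chi>
    using atoms_interpolant[OF finite_subfms] atoms_subfms by fastforce
  moreover have "{\<phi>} \<tturnstile> interpolant (subfms \<phi>) \<psi> \<^bold>\<or> interpolant (subfms \<phi>) \<theta>"
    using assms by (intro derives_Disj_interpolants)
      (auto simp: Imp_IPC_iff finite_subfms subfm_closed_subfms self_in_subfms)
  ultimately show ?thesis
    by (simp add: PDI_def Imp_IPC_iff interpolant_derives finite_subfms)
qed

theorem theorem5p8:
  shows "PDIP (IPC :: 'a fm set) \<and> mPDIP (IPC :: 'a fm set)"
proof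
  show "PDIP (IPC :: 'a fm set)"
    unfolding PDIP_def by (blast intro: PDI_interpolants)
  have "monotone_fm (interpolant (subfms \<phi>) \<chi>)" if "monotone_fm \<phi>" for \<phi> \<chi> :: "'a fm"
    using that by (blast intro: monotone_interpolant finite_subfms monotone_subfms)
  then show "mPDIP (IPC :: 'a fm set)"
    unfolding mPDIP_def mPDI_def by (blast intro: PDI_interpolants)
qed

end
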